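(* Let $A=\gamma(I-A_1)\in\mathcal{QT}_\infty$ with $\gamma>0$, $A_1\ge 0$ and $\|A_1\|_\infty<1$, and let $B=T(b)+E_B\in\mathcal{QT}_\infty$ be the unique matrix in $\mathcal{QT}_\infty$ with $B\ge 0$, $\|B\|_\infty<1$ and $\gamma(I-B)^2=A$, where $T(b)$, $b(z)=\sum_{j\in\mathbb Z}b_jz^j$, is the Toeplitz part of $B$. Suppose $b''\in\mathcal W$ and $b''(1)>0$. Let $n$ be a positive integer, $m=2n$, $\omega_m=\cos\frac{2\pi}{m}+\mathbf i\sin\frac{2\pi}{m}$, and let $\hat b(z)=\sum_{j=-n+1}^n\hat b_jz^j$ be the unique Laurent polynomial of this form with $\hat b(\omega_m^\ell)=b(\omega_m^\ell)$ for $\ell=-n+1,\dots,n$. If $\epsilon>0$ and $b''(1)-\hat b''(1)<\epsilon$, then $|b_j-\hat b_j|\le \epsilon/(2n)$ for $j=-n+1,\dots,n$, and $$\|b-\hat b\|_{\mathcal W}\le\Bigl(1+\frac1{2n}\Bigr)\epsilon .$$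
   Context: The Wiener algebra is $\mathcal W=\{a(z)=\sum_{i\in\mathbb Z}a_iz^i : |z|=1,\ \|a\|_{\mathcal W}:=\sum_{i\in\mathbb Z}|a_i|<\infty\}$; for $a\in\mathcal W$, $a''(z)=\sum_{i\in\mathbb Z}i(i-1)a_iz^{i-2}$. For $a\in\mathcal W$, $T(a)$ is the semi-infinite Toeplitz matrix with entries $(T(a))_{i,j}=a_{j-i}$, $i,j\in\mathbb Z^+=\{1,2,\dots\}$. Let $\mathcal K_d(\ell^\infty)$ be the set of infinite matrices $E=(e_{i,j})_{i,j\in\mathbb Z^+}$ (representing bounded operators on $\ell^\infty$) with $\lim_{i\to\infty}\sum_{j=1}^\infty|e_{i,j}|=0$. The class of quasi-Toeplitz matrices is $\mathcal{QT}_\infty=\{T(a)+E : a\in\mathcal W,\ E\in\mathcal K_d(\ell^\infty)\}$; it is a Banach algebra of bounded operators on $\ell^\infty$ with the norm $\|A\|_\infty=\sup_i\sum_{j=1}^\infty|a_{i,j}|$. For $A=T(a)+E\in\mathcal{QT}_\infty$, $T(a)$ is the Toeplitz part (with symbol $a$) and $E$ the correction part of $A$. For an infinite matrix, $B\ge 0$ means that all entries are nonnegative; $I$ is the infinite identity matrix. It is known that if $A_1\in\mathcal{QT}_\infty$, $A_1\ge0$, $\|A_1\|_\infty<1$, there is a unique $B\in\mathcal{QT}_\infty$ with $B\ge 0$, $\|B\|_\infty<1$ and $(I-B)^2=I-A_1$. *)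

theory Defs
  imports "HOL-Analysis.Analysis" "HOL-Library.Complex_Order"
begin

(* An element of the Wiener algebra is represented by its family of Laurent
   coefficients; symbol_at a is the function z |-> sum_i a_i z^i. *)

type_synonym laurent = "int \<Rightarrow> complex"

definition wiener :: "laurent set" where
  "wiener = {a. (\<lambda>i. cmod (a i)) summable_on UNIV}"

definition wiener_norm :: "laurent \<Rightarrow> real" where
  "wiener_norm a = (\<Sum>\<^sub>\<infinity>i. cmod (a i))"

definition symbol_at :: "laurent \<Rightarrow> complex \<Rightarrow> complex" where
  "symbol_at a z = (\<Sum>\<^sub>\<infinity>i. a i * z powi i)"

(* The coefficient of z^k in sum_i i (i - 1) a_i z^(i - 2) is the one with i = k + 2. *)
definition second_deriv :: "laurent \<Rightarrow> laurent" where
  "second_deriv a = (\<lambda>k. of_int ((k + 2) * (k + 1)) * a (k + 2))"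

(* Semi-infinite matrices; rows and columns are numbered from 0 instead of 1,
   which does not affect the Toeplitz structure since only j - i matters. *)

type_synonym inf_mat = "nat \<Rightarrow> nat \<Rightarrow> complex"

definition mat_id :: inf_mat where
  "mat_id = (\<lambda>i j. if i = j then 1 else 0)"

definition mat_add :: "inf_mat \<Rightarrow> inf_mat \<Rightarrow> inf_mat" where
  "mat_add A B = (\<lambda>i j. A i j + B i j)"

definition mat_diff :: "inf_mat \<Rightarrow> inf_mat \<Rightarrow> inf_mat" where
  "mat_diff A B = (\<lambda>i j. A i j - B i j)"

definition mat_scale :: "real \<Rightarrow> inf_mat \<Rightarrow> inf_mat" where
  "mat_scale c A = (\<lambda>i j. of_real c * A i j)"

definition mat_prod :: "inf_mat \<Rightarrow> inf_mat \<Rightarrow> inf_mat" where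
  "mat_prod A B = (\<lambda>i j. \<Sum>\<^sub>\<infinity>k. A i k * B k j)"

(* The order on complex numbers is that of Complex_Order:
   0 <= z means that z is real and nonnegative. *)
definition mat_nonneg :: "inf_mat \<Rightarrow> bool" where
  "mat_nonneg A \<longleftrightarrow> (\<forall>i j. 0 \<le> A i j)"

(* A represents a bounded operator on l^infinity iff its absolute row sums are
   uniformly bounded; their supremum is then the operator norm. *)
definition bounded_mat :: "inf_mat \<Rightarrow> bool" where
  "bounded_mat A \<longleftrightarrow>
     (\<forall>i. (\<lambda>j. cmod (A i j)) summable_on UNIV) \<and>
     bdd_above (range (\<lambda>i. \<Sum>\<^sub>\<infinity>j. cmod (A i j)))"

(* Meaningful only for bounded_mat A, in particular for A in QT. *)
definition mat_norm :: "inf_mat \<Rightarrow> real" where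
  "mat_norm A = (SUP i. \<Sum>\<^sub>\<infinity>j. cmod (A i j))"

definition toeplitz :: "laurent \<Rightarrow> inf_mat" where
  "toeplitz a = (\<lambda>i j. a (int j - int i))"

definition Kd :: "inf_mat set" where
  "Kd = {E. bounded_mat E \<and> (\<lambda>i. \<Sum>\<^sub>\<infinity>j. cmod (E i j)) \<longlonglongrightarrow> 0}"

definition QT :: "inf_mat set" where
  "QT = {mat_add (toeplitz a) E | a E. a \<in> wiener \<and> E \<in> Kd}"

end

theory Submission
  imports Defs
begin

text \<open>The entries of \<open>B\<close> along a diagonal converge to the corresponding coefficient of \<open>b\<close>, so
  \<open>b\<close> has nonnegative coefficients. The interpolation condition forces aliasing:
  \<open>bhat j\<close> is the sum of all \<open>b k\<close> with \<open>k \<equiv> j (mod 2n)\<close>. If \<open>k = j + 2nt\<close> with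
  \<open>t \<noteq> 0\<close> and \<open>j\<close> in the window \<open>{-n+1..n}\<close>, then
  \<open>k (k - 1) - j (j - 1) = 2nt (2j + 2nt - 1) \<ge> 2n\<close>; hence \<open>b''(1) - bhat''(1)\<close> is at least \<open>2n\<close>
  times the sum \<open>S\<close> of the coefficients of \<open>b\<close> outside the window, i.e. \<open>S \<le> \<epsilon> / (2n)\<close>.
  Finally \<open>\<bar>b j - bhat j\<bar> \<le> S\<close> and the Wiener norm of \<open>b - bhat\<close> equals \<open>2 S\<close>.\<close>

section \<open>Auxiliary facts and nonnegativity of the symbol\<close>

lemma has_sum_sum:
  fixes f :: "'i \<Rightarrow> 'a \<Rightarrow> 'b::topological_comm_monoid_add"
  assumes "\<And>i. i \<in> I \<Longrightarrow> (f i has_sum s i) A"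
  shows "((\<lambda>x. \<Sum>i\<in>I. f i x) has_sum (\<Sum>i\<in>I. s i)) A"
  using assms by (induction I rule: infinite_finite_induct) (auto intro: has_sum_add)

lemma has_sum_diff:
  fixes f g :: "'a \<Rightarrow> 'b::topological_ab_group_add"
  assumes "(f has_sum s) A" "(g has_sum t) A"
  shows "((\<lambda>x. f x - g x) has_sum (s - t)) A"
  using has_sum_add[OF assms(1), of "\<lambda>x. - g x" "- t"] assms(2)
  by (simp add: has_sum_uminus)

text \<open>On the diagonal of offset \<open>k\<close> every entry of the matrix is
  \<open>b k\<close> plus an entry of \<open>E\<close>. That entry is bounded by its absolute row
  sum, which tends to 0, so \<open>b k\<close> is a limit of nonnegative numbers.\<close>

lemma toeplitz_coeff_nonneg:
  assumes "E \<in> Kd" "mat_nonneg (mat_add (toeplitz b) E)"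
  shows "0 \<le> b k"
proof -
  \<comment> \<open>One of \<open>nat (- k)\<close> and \<open>nat k\<close> is 0, so these
    positions run through the diagonal of offset \<open>k\<close> from its first entry on, whatever
    the sign of \<open>k\<close>.\<close>
  define row where "row i = i + nat (- k)" for i
  define col where "col i = i + nat k" for i
  have diag: "int (col i) - int (row i) = k" for i
    by (simp add: row_def col_def)
  have summ: "(\<lambda>j. cmod (E i j)) summable_on UNIV" for i
    using assms(1) by (auto simp: Kd_def bounded_mat_def)
  have le: "cmod (E (row i) (col i)) \<le> (\<Sum>\<^sub>\<infinity>j. cmod (E (row i) j))" for i
    using finite_sum_le_infsum[OF summ, of "{col i}" "row i"] by simp
  have "(\<lambda>i. \<Sum>\<^sub>\<infinity>j. cmod (E (row i) j)) \<longlonglongrightarrow> 0"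
    using assms(1) LIMSEQ_ignore_initial_segment unfolding Kd_def row_def by blast
  then have "(\<lambda>i. E (row i) (col i)) \<longlonglongrightarrow> 0"
    by (rule Lim_null_comparison[rotated]) (simp add: le)
  then have lim: "(\<lambda>i. b k + E (row i) (col i)) \<longlonglongrightarrow> b k"
    by (auto intro!: tendsto_eq_intros)
  have nonneg: "0 \<le> b k + E (row i) (col i)" for i
    using assms(2) diag[of i] unfolding mat_nonneg_def mat_add_def toeplitz_def
    by metis
  have "0 \<le> Re (b k)"
    using nonneg by (intro LIMSEQ_le_const[OF tendsto_Re[OF lim]]) (auto simp: less_eq_complex_def)
  moreover have "(\<lambda>i. Im (b k + E (row i) (col i))) = (\<lambda>i. 0)"
    using nonneg by (auto simp: less_eq_complex_def)
  with tendsto_Im[OF lim] have "Im (b k) = 0"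
    by (simp add: LIMSEQ_const_iff)
  ultimately show ?thesis
    by (simp add: less_eq_complex_def)
qed

section \<open>Roots of unity and aliasing\<close>

lemma cis_int_mult_eq_1_iff:
  assumes "m > 0"
  shows "cis (2 * pi / real m) powi d = 1 \<longleftrightarrow> int m dvd d"
proof
  assume "cis (2 * pi / real m) powi d = 1"
  \<comment> \<open>The real part alone suffices: the cosine is 1 only at integer multiples of 2
    pi.\<close>
  then have "cos (of_int d * (2 * pi / real m)) = 1"
    by (simp add: cis_power_int complex_eq_iff)
  then obtain q :: int where "of_int d * (2 * pi / real m) = of_int q * 2 * pi"
    using cos_one_2pi_int by blast
  then have "real_of_int d = of_int (int m * q)"
    using assms by (simp add: field_simps)
  then show "int m dvd d"
    by (metis of_int_eq_iff dvd_triv_left)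
next
  assume "int m dvd d"
  then obtain q where q: "d = int m * q" by blast
  have "of_int d * (2 * pi / real m) = 2 * pi * of_int q"
    using assms by (simp add: q)
  then show "cis (2 * pi / real m) powi d = 1"
    by (simp add: cis_power_int)
qed

text \<open>A geometric sum of ratio \<open>z = \<omega> powi d\<close> over 2n consecutive
  exponents; since \<open>z ^ (2 * n) = 1\<close>, it vanishes unless \<open>z = 1\<close>.\<close>

lemma sum_powers_root_of_unity_window:
  fixes n :: nat and d :: int
  assumes "n > 0"
  defines "\<omega> \<equiv> cis (2 * pi / real (2 * n))"
  shows "(\<Sum>l\<in>{- int n + 1..int n}. \<omega> powi (d * l)) = (if 2 * int n dvd d then of_nat (2 * n) else 0)"
proof -
  define z where "z = \<omega> powi d"
  have [simp]: "z \<noteq> 0" by (simp add: z_def \<omega>_def power_int_0_left_if)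
  have z1: "z = 1 \<longleftrightarrow> 2 * int n dvd d"
    using cis_int_mult_eq_1_iff[of "2 * n" d] assms by (simp add: z_def)
  have "z ^ (2 * n) = \<omega> powi (d * int (2 * n))"
    by (simp only: z_def power_int_mult power_int_of_nat)
  also have "\<dots> = 1"
    using cis_int_mult_eq_1_iff[of "2 * n" "d * int (2 * n)"] assms by simp
  finally have root: "z ^ (2 * n) = 1" .
  have "(\<Sum>l\<in>{- int n + 1..int n}. \<omega> powi (d * l)) = (\<Sum>i<2 * n. z powi (- int n + 1 + int i))"
    by (rule sum.reindex_bij_witness
        [of _ "\<lambda>i. - int n + 1 + int i" "\<lambda>l. nat (l + int n - 1)"])
       (auto simp: z_def power_int_mult)
  also have "\<dots> = z powi (- int n + 1) * (\<Sum>i<2 * n. z ^ i)"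
    by (simp add: power_int_add sum_distrib_left)
  also have "\<dots> = (if 2 * int n dvd d then of_nat (2 * n) else 0)"
    using z1 root by (auto simp: geometric_sum)
  finally show ?thesis .
qed

text \<open>The unnormalized inverse discrete Fourier transform of the values at the nodes: by
  orthogonality of the characters only the coefficients with index in the residue class of
  \<open>j\<close> survive, each multiplied by 2n.\<close>

lemma discrete_fourier_has_sum:
  fixes n :: nat
  assumes "n > 0" and a: "a \<in> wiener"
  defines "\<omega> \<equiv> cis (2 * pi / real (2 * n))"
  shows "((\<lambda>k. if 2 * int n dvd k - j then of_nat (2 * n) * a k else 0) has_sum
    (\<Sum>l\<in>{- int n + 1..int n}. \<omega> powi (- (j * l)) * symbol_at a (\<omega> powi l))) UNIV"
proof -
  have [simp]: "\<omega> \<noteq> 0" by (simp add: \<omega>_def)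
  have "((\<lambda>k. a k * (\<omega> powi l) powi k) has_sum symbol_at a (\<omega> powi l)) UNIV" for l
  proof -
    have "cmod (a k * (\<omega> powi l) powi k) = cmod (a k)" for k
      by (simp add: norm_mult norm_power_int \<omega>_def)
    then have "(\<lambda>k. a k * (\<omega> powi l) powi k) summable_on UNIV"
      using a by - (rule abs_summable_summable, simp add: wiener_def)
    then show ?thesis
      unfolding symbol_at_def by (rule has_sum_infsum)
  qed
  then have "((\<lambda>k. \<Sum>l\<in>{- int n + 1..int n}. \<omega> powi (- (j * l)) * (a k * (\<omega> powi l) powi k)) has_sum
    (\<Sum>l\<in>{- int n + 1..int n}. \<omega> powi (- (j * l)) * symbol_at a (\<omega> powi l))) UNIV"
    by (intro has_sum_sum has_sum_cmult_right)
  moreover have "(\<Sum>l\<in>{- int n + 1..int n}. \<omega> powi (- (j * l)) * (a k * (\<omega> powi l) powi k)) =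
      (if 2 * int n dvd k - j then of_nat (2 * n) * a k else 0)" for k
  proof -
    have term_eq: "\<omega> powi (- (j * l)) * (a k * (\<omega> powi l) powi k) = a k * \<omega> powi ((k - j) * l)" for l
    proof -
      have "\<omega> powi ((k - j) * l) = \<omega> powi (- (j * l)) * \<omega> powi (l * k)"
        using power_int_add[of \<omega> "- (j * l)" "l * k"] by (simp add: algebra_simps)
      then show ?thesis
        by (simp only: power_int_mult[of \<omega> l k] mult.left_commute)
    qed
    then show ?thesis
      using sum_powers_root_of_unity_window[OF \<open>n > 0\<close>, of "k - j", folded \<omega>_def]
      by (simp add: term_eq flip: sum_distrib_left)
  qed
  ultimately show ?thesis by simp
qed

lemma finite_support_wiener:
  assumes "finite J" "\<And>j. j \<notin> J \<Longrightarrow> a j = 0"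
  shows "a \<in> wiener"
proof -
  have "((\<lambda>j. cmod (a j)) has_sum (\<Sum>j\<in>J. cmod (a j))) UNIV"
    using assms by (intro has_sum_finite_neutralI[of J]) auto
  then show ?thesis
    by (auto simp: wiener_def intro: has_sum_imp_summable)
qed

lemma window_congruent_unique:
  fixes j k :: int
  assumes "j \<in> {- int n + 1..int n}" "k \<in> {- int n + 1..int n}" "2 * int n dvd k - j"
  shows "k = j"
proof (rule ccontr)
  assume "k \<noteq> j"
  then have "2 * int n \<le> \<bar>k - j\<bar>"
    using assms(3) dvd_imp_le_int[of "k - j" "2 * int n"] by simp
  then show False using assms(1,2) by auto
qed

text \<open>Equal values at the nodes give \<open>a\<close> and \<open>c\<close> the same transform.
  For \<open>c\<close> the class of \<open>j\<close> meets the support only in \<open>j\<close>, so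
  the transform is \<open>2n * c j\<close>; dividing by 2n gives the claim.\<close>

lemma interpolant_coeff_has_sum:
  fixes n :: nat
  assumes "n > 0" and a: "a \<in> wiener"
    and supp: "\<And>j. j \<notin> {- int n + 1..int n} \<Longrightarrow> c j = 0"
    and interp: "\<And>l. l \<in> {- int n + 1..int n} \<Longrightarrow>
      symbol_at c (cis (2 * pi / real (2 * n)) powi l) = symbol_at a (cis (2 * pi / real (2 * n)) powi l)"
    and j: "j \<in> {- int n + 1..int n}"
  shows "((\<lambda>k. if 2 * int n dvd k - j then a k else 0) has_sum c j) UNIV"
proof -
  have "c \<in> wiener"
    using supp by (intro finite_support_wiener[of "{- int n + 1..int n}"]) auto
  define s where "s = (\<Sum>l\<in>{- int n + 1..int n}. cis (2 * pi / real (2 * n)) powi (- (j * l)) *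
    symbol_at a (cis (2 * pi / real (2 * n)) powi l))"
  have "s = (\<Sum>l\<in>{- int n + 1..int n}. cis (2 * pi / real (2 * n)) powi (- (j * l)) *
    symbol_at c (cis (2 * pi / real (2 * n)) powi l))"
    unfolding s_def by (rule sum.cong) (simp_all only: interp)
  with discrete_fourier_has_sum[OF \<open>n > 0\<close> \<open>c \<in> wiener\<close>, of j]
  have c: "((\<lambda>k. if 2 * int n dvd k - j then of_nat (2 * n) * c k else 0) has_sum s) UNIV"
    by simp
  have a: "((\<lambda>k. if 2 * int n dvd k - j then of_nat (2 * n) * a k else 0) has_sum s) UNIV"
    unfolding s_def by (rule discrete_fourier_has_sum[OF \<open>n > 0\<close> a])
  have "((\<lambda>k. if 2 * int n dvd k - j then of_nat (2 * n) * c k else 0) has_sum of_nat (2 * n) * c j) UNIV"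
    using window_congruent_unique[OF j] supp j
    by (intro has_sum_finite_neutralI[of "{j}"]) auto
  with c have s: "s = of_nat (2 * n) * c j"
    using has_sum_unique by blast
  have eq: "inverse (of_nat (2 * n)) * (if P then of_nat (2 * n) * x else 0) = (if P then x else (0::complex))" for P x
    using \<open>n > 0\<close> by simp
  have "inverse (of_nat (2 * n)) * s = c j"
    using \<open>n > 0\<close> s by simp
  with has_sum_cmult_right[OF a, of "inverse (of_nat (2 * n))"] show ?thesis
    by (simp only: eq)
qed

section \<open>Second derivatives at 1 and the aliasing gap\<close>

lemma second_deriv_at_1_has_sum:
  assumes "second_deriv a \<in> wiener"
  shows "((\<lambda>i. of_int (i * (i - 1)) * a i) has_sum symbol_at (second_deriv a) 1) UNIV"
proof -
  have "(second_deriv a has_sum symbol_at (second_deriv a) 1) UNIV"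
    using assms unfolding symbol_at_def wiener_def
    by (simp add: abs_summable_summable)
  moreover have "second_deriv a = (\<lambda>k. (\<lambda>i. of_int (i * (i - 1)) * a i) (k + 2))"
    by (auto simp: second_deriv_def fun_eq_iff algebra_simps)
  moreover have "bij (\<lambda>k::int. k + 2)"
    by (rule o_bij[of "\<lambda>k. k - 2"]) auto
  ultimately show ?thesis
    using has_sum_reindex_bij_betw[of "\<lambda>k. k + 2" UNIV UNIV "\<lambda>i. of_int (i * (i - 1)) * a i"]
    by simp
qed

text \<open>For k = j + 2nt the difference is 2nt(2j - 1 + 2nt). The window and the parabola x(x -
  1) are both symmetric about 1/2, so |2j - 1| is at most 2n - 1; hence for nonzero t the last
  factor has the sign of t and absolute value at least 1.\<close>

lemma aliasing_gap:
  fixes j k :: int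
  assumes j: "j \<in> {- int n + 1..int n}" and "2 * int n dvd k - j" and "k \<noteq> j"
  shows "2 * int n \<le> k * (k - 1) - j * (j - 1)"
proof -
  obtain t where t: "k - j = 2 * int n * t" using assms(2) by blast
  have "t \<noteq> 0" using t assms(3) by auto
  have "1 \<le> t * (2 * j - 1 + 2 * int n * t)"
  proof (cases "t > 0")
    case True
    then have "2 * int n * 1 \<le> 2 * int n * t" by (intro mult_left_mono) auto
    then have "1 \<le> 2 * j - 1 + 2 * int n * t"
      using j unfolding atLeastAtMost_iff by linarith
    with True mult_mono[of 1 t 1 "2 * j - 1 + 2 * int n * t"] show ?thesis by simp
  next
    case False
    with \<open>t \<noteq> 0\<close> have "t \<le> -1" by simp
    then have "2 * int n * t \<le> 2 * int n * (-1)" by (intro mult_left_mono) auto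
    then have "2 * j - 1 + 2 * int n * t \<le> -1"
      using j unfolding atLeastAtMost_iff by linarith
    with \<open>t \<le> -1\<close> have "1 * 1 \<le> (- t) * (- (2 * j - 1 + 2 * int n * t))"
      by (intro mult_mono) linarith+
    then show ?thesis by (simp only: minus_mult_minus mult_1_right)
  qed
  then have "2 * int n * 1 \<le> 2 * int n * (t * (2 * j - 1 + 2 * int n * t))"
    by (intro mult_left_mono) auto
  moreover have "k * (k - 1) - j * (j - 1) = (k - j) * (2 * j - 1 + (k - j))"
    by (simp add: algebra_simps)
  ultimately show ?thesis
    by (simp only: t mult.assoc mult_1_right)
qed

text \<open>The remainder modulo 2n lies in 0..2n-1; shifting by n - 1 before and after moves this
  range to the window.\<close>

lemma window_representative:
  fixes n :: nat
  assumes "n > 0"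
  obtains r where "\<And>k. r k \<in> {- int n + 1..int n}" "\<And>k. 2 * int n dvd k - r k"
proof
  let ?r = "\<lambda>k. (k + int n - 1) mod (2 * int n) - int n + 1"
  show "?r k \<in> {- int n + 1..int n}" for k
    using assms pos_mod_bound[of "2 * int n" "k + int n - 1"] pos_mod_sign[of "2 * int n" "k + int n - 1"]
    unfolding atLeastAtMost_iff by linarith
  show "2 * int n dvd k - ?r k" for k
  proof -
    have "k - ?r k = (k + int n - 1) - (k + int n - 1) mod (2 * int n)" by simp
    then show ?thesis by (metis dvd_minus_mod)
  qed
qed

section \<open>The error estimates\<close>

theorem mainTheorem4:
  fixes \<gamma> \<epsilon> :: real
    and A A\<^sub>1 B E\<^sub>B :: inf_mat
    and b bhat :: laurent
    and n m :: nat
    and \<omega> :: complex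
  assumes "A = mat_scale \<gamma> (mat_diff mat_id A\<^sub>1)"
    and "A \<in> QT"
    and "\<gamma> > 0"
    and "mat_nonneg A\<^sub>1"
    and "mat_norm A\<^sub>1 < 1"
    and "B \<in> QT"
    and "mat_nonneg B"
    and "mat_norm B < 1"
    and "mat_scale \<gamma> (mat_prod (mat_diff mat_id B) (mat_diff mat_id B)) = A"
    and "b \<in> wiener"
    and "E\<^sub>B \<in> Kd"
    and "B = mat_add (toeplitz b) E\<^sub>B"
    and "second_deriv b \<in> wiener"
    and "symbol_at (second_deriv b) 1 > 0"
    and "n > 0"
    and "m = 2 * n"
    and "\<omega> = Complex (cos (2 * pi / real m)) (sin (2 * pi / real m))"
    and "\<forall>j. j \<notin> {- int n + 1..int n} \<longrightarrow> bhat j = 0"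
    and "\<forall>l \<in> {- int n + 1..int n}. symbol_at bhat (\<omega> powi l) = symbol_at b (\<omega> powi l)"
    and "\<epsilon> > 0"
    and "symbol_at (second_deriv b) 1 - symbol_at (second_deriv bhat) 1 < complex_of_real \<epsilon>"
  shows "(\<forall>j \<in> {- int n + 1..int n}. cmod (b j - bhat j) \<le> \<epsilon> / (2 * real n)) \<and>
         wiener_norm (\<lambda>j. b j - bhat j) \<le> (1 + 1 / (2 * real n)) * \<epsilon>"
proof -
  define W where "W = {- int n + 1..int n}"
  define \<beta> where "\<beta> k = Re (b k)" for k
  define S where "S = (\<Sum>\<^sub>\<infinity>k. if k \<in> W then 0 else \<beta> k)"
  note [simp] = \<open>n > 0\<close>
  have finW: "finite W" by (simp add: W_def)
  have "0 \<le> b k" for k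
    using toeplitz_coeff_nonneg \<open>E\<^sub>B \<in> Kd\<close> \<open>mat_nonneg B\<close> \<open>B = mat_add (toeplitz b) E\<^sub>B\<close> by blast
  then have b: "b k = of_real (\<beta> k)" and \<beta>: "0 \<le> \<beta> k" for k
    by (auto simp: \<beta>_def less_eq_complex_def complex_eq_iff)
  have \<beta>_summable: "\<beta> summable_on UNIV"
    using \<open>b \<in> wiener\<close> \<beta> by (simp add: wiener_def b)
  have "(\<lambda>k. if k \<in> W then 0 else \<beta> k) summable_on UNIV"
    by (rule summable_on_comparison_test[OF \<beta>_summable]) (use \<beta> in auto)
  then have S: "((\<lambda>k. if k \<in> W then 0 else \<beta> k) has_sum S) UNIV"
    unfolding S_def by (rule has_sum_infsum)
  have \<omega>: "\<omega> = cis (2 * pi / real (2 * n))"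
    using assms(16,17) by (simp add: cis.code)
  \<comment> \<open>With the representative as a function \<open>r\<close>, the congruence
    conditions become \<open>r k = j\<close>, and finite sums over \<open>W\<close> collapse to the
    single term \<open>j = r k\<close>.\<close>
  obtain r where rW: "r k \<in> W" and r_dvd: "2 * int n dvd k - r k" for k
    using window_representative[OF \<open>n > 0\<close>] unfolding W_def by blast
  have r_iff: "2 * int n dvd k - j \<longleftrightarrow> r k = j" if "j \<in> W" for k j
  proof
    assume "2 * int n dvd k - j"
    then have "2 * int n dvd (k - j) - (k - r k)" using r_dvd by (rule dvd_diff)
    then have "2 * int n dvd r k - j" by simp
    with that rW[of k] show "r k = j"
      unfolding W_def by (intro window_congruent_unique[of j n "r k"])
  qed (use r_dvd in auto)
  have r_id: "r k = k" if "k \<in> W" for k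
    using r_iff[OF that, of k] by simp
  have aliased: "((\<lambda>k. if r k = j then b k else 0) has_sum bhat j) UNIV" if "j \<in> W" for j
  proof -
    have "((\<lambda>k. if 2 * int n dvd k - j then b k else 0) has_sum bhat j) UNIV"
    proof (rule interpolant_coeff_has_sum[OF \<open>n > 0\<close> \<open>b \<in> wiener\<close>])
      show "bhat j = 0" if "j \<notin> {- int n + 1..int n}" for j
        using assms(18) that by blast
      show "symbol_at bhat (cis (2 * pi / real (2 * n)) powi l) = symbol_at b (cis (2 * pi / real (2 * n)) powi l)"
        if "l \<in> {- int n + 1..int n}" for l
        using assms(19) that unfolding \<omega> by blast
    qed (use that in \<open>simp add: W_def\<close>)
    then show ?thesis
      by (simp add: r_iff[OF that])
  qed
  \<comment> \<open>The error \<open>bhat j - b j\<close> is the sum of the remaining coefficients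
    in the class of \<open>j\<close>. These are nonnegative, so its modulus is given exactly by the
    series.\<close>
  have diff: "((\<lambda>k. if r k = j \<and> k \<noteq> j then \<beta> k else 0) has_sum cmod (b j - bhat j)) UNIV"
    if "j \<in> W" for j
  proof -
    have "((\<lambda>k. if k = j then b k else 0) has_sum b j) UNIV"
      by (rule has_sum_finite_neutralI[of "{j}"]) auto
    from has_sum_diff[OF aliased[OF that] this]
    have "((\<lambda>k. (if r k = j then b k else 0) - (if k = j then b k else 0)) has_sum bhat j - b j) UNIV" .
    moreover have "(if r k = j then b k else 0) - (if k = j then b k else 0)
        = of_real (if r k = j \<and> k \<noteq> j then \<beta> k else 0)" for k
      using r_id[OF that] by (auto simp: b)
    ultimately have c: "((\<lambda>k. complex_of_real (if r k = j \<and> k \<noteq> j then \<beta> k else 0)) has_sum bhat j - b j) UNIV"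
      by simp
    from has_sum_Re[OF c] have re_sum: "((\<lambda>k. if r k = j \<and> k \<noteq> j then \<beta> k else 0) has_sum Re (bhat j - b j)) UNIV"
      by simp
    have "bhat j - b j = of_real (Re (bhat j - b j))"
      using has_sum_unique[OF c has_sum_of_real[OF re_sum]] .
    moreover have "0 \<le> Re (bhat j - b j)"
      using has_sum_nonneg[OF re_sum] \<beta> by auto
    ultimately have "cmod (bhat j - b j) = Re (bhat j - b j)"
      by (metis norm_of_real abs_of_nonneg)
    with re_sum show ?thesis
      by (simp only: norm_minus_commute[of "b j"])
  qed
  \<comment> \<open>Inserting the aliasing series into the second derivative of \<open>bhat\<close>
    at 1 turns it into a series over the coefficients of \<open>b\<close>, where \<open>b k\<close>
    carries the weight of \<open>r k\<close> instead of that of \<open>k\<close>.\<close>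
  have "((\<lambda>k. \<Sum>j\<in>W. of_int (j * (j - 1)) * (if r k = j then b k else 0)) has_sum
      (\<Sum>j\<in>W. of_int (j * (j - 1)) * bhat j)) UNIV"
    by (intro has_sum_sum has_sum_cmult_right aliased)
  moreover have "(\<Sum>j\<in>W. of_int (j * (j - 1)) * (if r k = j then b k else 0)) =
      of_int (r k * (r k - 1)) * b k" for k
    using rW[of k] finW by (simp add: if_distrib[where f = "\<lambda>x. _ * x"] cong: if_cong)
  moreover have "(\<Sum>j\<in>W. of_int (j * (j - 1)) * bhat j) = symbol_at (second_deriv bhat) 1"
  proof -
    have supp: "bhat j = 0" if "j \<notin> W" for j
      using assms(18) that by (auto simp: W_def)
    have "second_deriv bhat \<in> wiener"
    proof (rule finite_support_wiener)
      show "finite ((\<lambda>j. j - 2) ` W)" using finW by simp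
      show "second_deriv bhat k = 0" if "k \<notin> (\<lambda>j. j - 2) ` W" for k
      proof -
        have "k + 2 \<notin> W"
        proof
          assume "k + 2 \<in> W"
          then have "(k + 2) - 2 \<in> (\<lambda>j. j - 2) ` W" by (rule imageI)
          with that show False by simp
        qed
        then show ?thesis by (simp add: second_deriv_def supp)
      qed
    qed
    from second_deriv_at_1_has_sum[OF this]
    have "((\<lambda>i. of_int (i * (i - 1)) * bhat i) has_sum symbol_at (second_deriv bhat) 1) UNIV" .
    moreover have "((\<lambda>i. of_int (i * (i - 1)) * bhat i) has_sum (\<Sum>j\<in>W. of_int (j * (j - 1)) * bhat j)) UNIV"
      by (rule has_sum_finite_neutralI[OF finW]) (auto simp: supp)
    ultimately show ?thesis using has_sum_unique by blast
  qed
  ultimately have "((\<lambda>k. of_int (r k * (r k - 1)) * b k) has_sum symbol_at (second_deriv bhat) 1) UNIV"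
    by simp
  from has_sum_Re[OF has_sum_diff[OF second_deriv_at_1_has_sum[OF \<open>second_deriv b \<in> wiener\<close>] this]]
  have gap: "((\<lambda>k. of_int (k * (k - 1) - r k * (r k - 1)) * \<beta> k) has_sum
      Re (symbol_at (second_deriv b) 1 - symbol_at (second_deriv bhat) 1)) UNIV"
    by (simp add: b left_diff_distrib)
  \<comment> \<open>Termwise comparison: inside the window both sides are 0, outside it the
    difference of the weights is at least 2n.\<close>
  have "2 * real n * S \<le> Re (symbol_at (second_deriv b) 1 - symbol_at (second_deriv bhat) 1)"
  proof (rule has_sum_mono[OF has_sum_cmult_right[OF S] gap])
    fix k
    show "2 * real n * (if k \<in> W then 0 else \<beta> k) \<le> of_int (k * (k - 1) - r k * (r k - 1)) * \<beta> k"
    proof (cases "k \<in> W")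
      case False
      with rW[of k] have "k \<noteq> r k" by auto
      then have "2 * int n \<le> k * (k - 1) - r k * (r k - 1)"
        using rW[of k] r_dvd[of k] unfolding W_def by (intro aliasing_gap)
      then have "real_of_int (2 * int n) \<le> of_int (k * (k - 1) - r k * (r k - 1))"
        by (rule of_int_le_iff[THEN iffD2])
      then have "real_of_int (2 * int n) * \<beta> k \<le> of_int (k * (k - 1) - r k * (r k - 1)) * \<beta> k"
        using \<beta> by (rule mult_right_mono)
      with False show ?thesis by simp
    qed (simp add: r_id)
  qed
  \<comment> \<open>The strict order on complex numbers includes the strict inequality of the real
    parts.\<close>
  also have "\<dots> < \<epsilon>"
    using assms(21) by (simp add: less_complex_def)
  finally have S_less: "2 * real n * S < \<epsilon>" .
  have S_le: "S \<le> \<epsilon> / (2 * real n)"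
    using S_less by (simp add: field_simps)
  \<comment> \<open>Since \<open>r\<close> fixes \<open>W\<close>, every index \<open>k\<close>
    other than \<open>j\<close> with \<open>r k = j\<close> lies outside the window and is counted
    in \<open>S\<close>.\<close>
  have "cmod (b j - bhat j) \<le> S" if "j \<in> W" for j
    by (rule has_sum_mono[OF diff[OF that] S]) (use \<beta> r_id in auto)
  then have coeffs: "\<forall>j\<in>W. cmod (b j - bhat j) \<le> \<epsilon> / (2 * real n)"
    using S_le by force
  \<comment> \<open>Each index outside the window belongs to exactly one residue class, so the
    errors inside the window add up to \<open>S\<close>.\<close>
  have "((\<lambda>k. \<Sum>j\<in>W. if r k = j \<and> k \<noteq> j then \<beta> k else 0) has_sum (\<Sum>j\<in>W. cmod (b j - bhat j))) UNIV"
    by (intro has_sum_sum diff)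
  moreover have "(\<Sum>j\<in>W. if r k = j \<and> k \<noteq> j then \<beta> k else 0) = (if k \<in> W then 0 else \<beta> k)" for k
  proof -
    have "(\<Sum>j\<in>W. if r k = j \<and> k \<noteq> j then \<beta> k else 0) = (\<Sum>j\<in>W. if r k = j then (if k \<in> W then 0 else \<beta> k) else 0)"
      using r_id rW[of k] by (intro sum.cong) auto
    then show ?thesis using rW[of k] finW by simp
  qed
  ultimately have inside: "(\<Sum>j\<in>W. cmod (b j - bhat j)) = S"
    using has_sum_unique[OF _ S] by simp
  have "((\<lambda>j. if j \<in> W then cmod (b j - bhat j) else 0) has_sum (\<Sum>j\<in>W. cmod (b j - bhat j))) UNIV"
    by (rule has_sum_finite_neutralI[OF finW]) auto
  \<comment> \<open>Outside the window \<open>bhat\<close> vanishes and the error is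
    \<open>b\<close> itself, which contributes a second \<open>S\<close> to the norm.\<close>
  from has_sum_add[OF this S]
  have "((\<lambda>j. (if j \<in> W then cmod (b j - bhat j) else 0) + (if j \<in> W then 0 else \<beta> j)) has_sum S + S) UNIV"
    by (simp only: inside)
  moreover have "(if j \<in> W then cmod (b j - bhat j) else 0) + (if j \<in> W then 0 else \<beta> j) = cmod (b j - bhat j)" for j
    using assms(18) \<beta> by (auto simp: W_def b)
  ultimately have "wiener_norm (\<lambda>j. b j - bhat j) = 2 * S"
    unfolding wiener_norm_def by (simp add: infsumI)
  \<comment> \<open>As n is at least 1, the norm \<open>2 * S\<close> is at most
    \<open>2 * real n * S\<close>, which was shown to be below \<epsilon>.\<close>
  also have "\<dots> \<le> 2 * real n * S"
  proof -
    have "0 \<le> S" by (rule has_sum_nonneg[OF S]) (use \<beta> in auto)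
    moreover have "1 \<le> real n" using \<open>n > 0\<close> by linarith
    ultimately show ?thesis using mult_right_mono[of 1 "real n" S] by simp
  qed
  also have "\<dots> \<le> (1 + 1 / (2 * real n)) * \<epsilon>"
    using S_less \<open>\<epsilon> > 0\<close> by (simp add: distrib_right)
      (smt (verit) divide_nonneg_nonneg of_nat_0_le_iff)
  finally have "wiener_norm (\<lambda>j. b j - bhat j) \<le> (1 + 1 / (2 * real n)) * \<epsilon>" .
  with coeffs show ?thesis by (simp add: W_def)
qed

end
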